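(* Consider a search problem on a finite directed graph with start node $v_0$, all of whose nodes are reachable from $v_0$, with maximum level $D$, and let $L(0,d)$ be the number of nodes on level $d$ for $0\le d\le D$. Let $\mathbf p=[p_0,\dots,p_D]\in[0,1]^{D+1}$, $\mathbf p\ne\mathbf 0$, and suppose that, independently over all nodes, each node on level $k$ is a goal with probability $p_k$. Let $\Gamma_k$ be the event that level $k$ contains a goal, let $F_k=\Gamma_k\cap\bigcap_{i=0}^{k-1}\overline{\Gamma_i}$ for $0\le k\le D$, let $F_{D+1}$ be the event that no goal exists, and extend the goal probabilities by $p_{D+1}=1$. Put $U_k=\sum_{i=0}^{k-1}L(0,i)$ for $0\le k\le D+1$. Then the expected number of nodes that BFS (graph search) needs to search to find a goal is $$\sum_{k=0}^{D+1}P(F_k)\,\bigl(U_k+\mathrm{tc}(p_k,L(0,k))\bigr),$$ where for $0\le k\le D$ one has $P(F_k)=\bigl(1-(1-p_k)^{L(0,k)}\bigr)\prod_{i=0}^{k-1}(1-p_i)^{L(0,i)}$, and for $k=D+1$ the factor $\mathrm{tc}(p_{D+1},L(0,D+1))$ is read as $\mathrm{tc}(1,m)=1$ (any $m\ge1$).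
   Context: The level of a node $v$ is the length of a shortest path from $v_0$ to $v$; $D$ is the maximum level. Breadth-first graph search (BFS) explores each node once, level by level starting from $v_0$, in an order within each level that does not depend on the goals, stopping as soon as a goal is explored. The number of nodes searched is the number of nodes explored up to and including the first goal found; if no goal exists, it is defined as the number of nodes of the graph plus one. For $p\in(0,1]$ and an integer $m\ge1$, $\mathrm{tc}(p,m)=\mathbb{E}[X\mid X\le m]$ where $X$ is geometric with $P(X=k)=(1-p)^{k-1}p$ for $k=1,2,\dots$; explicitly $$\mathrm{tc}(p,m)=\frac{1-(1-p)^m(pm+1)}{p\,(1-(1-p)^m)}.$$ Convention: $0\cdot\text{undefined}=0$; when $p_k=0$, $\mathrm{tc}(p_k,\cdot)$ is undefined but $P(F_k)=0$, and the term is $0$. *)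

theory Defs
  imports "HOL-Probability.Probability" "Graph_Theory.Graph_Theory"
begin

definition level :: "('a, 'e) pre_digraph \<Rightarrow> 'a \<Rightarrow> 'a \<Rightarrow> nat" where
  "level G v0 v = (LEAST n. \<exists>p. pre_digraph.apath G v0 p v \<and> length p = n)"

definition max_level :: "('a, 'e) pre_digraph \<Rightarrow> 'a \<Rightarrow> nat" where
  "max_level G v0 = Max (level G v0 ` verts G)"

definition level_size :: "('a, 'e) pre_digraph \<Rightarrow> 'a \<Rightarrow> nat \<Rightarrow> nat" where
  "level_size G v0 d = card {v \<in> verts G. level G v0 v = d}"

text \<open>An admissible exploration order of breadth-first graph search: every node occurs exactly once,
  and the levels are visited one after the other; the order inside a level is arbitrary.\<close>

definition bfs_order :: "('a, 'e) pre_digraph \<Rightarrow> 'a \<Rightarrow> 'a list \<Rightarrow> bool" where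
  "bfs_order G v0 xs \<longleftrightarrow> distinct xs \<and> set xs = verts G \<and> sorted (map (level G v0) xs)"

lemma bfs_order_exists:
  assumes "finite (verts G)"
  shows "\<exists>xs. bfs_order G v0 xs"
proof -
  obtain ys where "set ys = verts G" "distinct ys"
    using finite_distinct_list[OF assms] by blast
  then have "bfs_order G v0 (sort_key (level G v0) ys)"
    by (simp add: bfs_order_def)
  then show ?thesis ..
qed

text \<open>The nodes explored when the search runs through a given order and stops as soon as it
  explores an element of the goal set.\<close>

primrec explored :: "'a set \<Rightarrow> 'a list \<Rightarrow> 'a list" where
  "explored T [] = []"
| "explored T (x # xs) = (if x \<in> T then [x] else x # explored T xs)"

definition nodes_searched :: "('a, 'e) pre_digraph \<Rightarrow> 'a list \<Rightarrow> 'a set \<Rightarrow> nat" where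
  "nodes_searched G xs T =
     (if \<exists>v \<in> verts G. v \<in> T then length (explored T xs) else card (verts G) + 1)"

text \<open>Here \<open>goals\<close> is the random set of goal nodes on the probability space \<open>M\<close>.\<close>

definition goal_on_level ::
  "'w measure \<Rightarrow> ('a, 'e) pre_digraph \<Rightarrow> 'a \<Rightarrow> ('w \<Rightarrow> 'a set) \<Rightarrow> nat \<Rightarrow> 'w set" where
  "goal_on_level M G v0 goals k =
     {\<omega> \<in> space M. \<exists>v \<in> verts G. level G v0 v = k \<and> v \<in> goals \<omega>}"

definition first_goal_level ::
  "'w measure \<Rightarrow> ('a, 'e) pre_digraph \<Rightarrow> 'a \<Rightarrow> ('w \<Rightarrow> 'a set) \<Rightarrow> nat \<Rightarrow> 'w set" where
  "first_goal_level M G v0 goals k =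
     (if k \<le> max_level G v0
      then goal_on_level M G v0 goals k \<inter> (\<Inter>i<k. space M - goal_on_level M G v0 goals i)
      else {\<omega> \<in> space M. \<not> (\<exists>v \<in> verts G. v \<in> goals \<omega>)})"

text \<open>The library's \<open>geometric_pmf\<close> counts failures and is supported on \<open>0, 1, \<dots>\<close>, so it is shifted
  by one. The value is unspecified outside \<open>0 < p \<le> 1\<close>, \<open>m \<ge> 1\<close>.\<close>

definition tc :: "real \<Rightarrow> nat \<Rightarrow> real" where
  "tc p m = measure_pmf.expectation (cond_pmf (map_pmf Suc (geometric_pmf p)) {..m}) real"

lemma tc_explicit:
  assumes p: "0 < p" "p \<le> 1" and m: "1 \<le> m"
  shows "tc p m = (1 - (1 - p) ^ m * (p * m + 1)) / (p * (1 - (1 - p) ^ m))"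
proof -
  let ?g = "map_pmf Suc (geometric_pmf p)"
  have pmf_Suc: "pmf ?g (Suc k) = (1 - p) ^ k * p" for k
    using p by (simp add: pmf_map_inj')
  have pmf_0: "pmf ?g 0 = 0"
    by (simp add: pmf_eq_0_set_pmf)
  have "Suc 0 \<in> set_pmf ?g"
    using pmf_Suc[of 0] p by (simp add: set_pmf_iff)
  then have ne: "set_pmf ?g \<inter> {..m} \<noteq> {}"
    using m by auto
  have atMost_eq: "{..m} = insert 0 (Suc ` {..<m})"
    by (auto simp: image_iff Suc_le_eq gr0_conv_Suc less_Suc_eq_le Bex_def) (metis Suc_le_eq not0_implies_Suc)
  have sum_Suc: "(\<Sum>k\<in>{..m}. f k) = f 0 + (\<Sum>k<m. f (Suc k))" for f :: "nat \<Rightarrow> real"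
    unfolding atMost_eq by (subst sum.insert) (auto simp: sum.reindex)
  have "measure_pmf.prob ?g {..m} = (\<Sum>k<m. (1 - p) ^ k * p)"
    by (subst measure_measure_pmf_finite) (simp_all only: finite_atMost sum_Suc pmf_0 pmf_Suc add_0)
  also have "\<dots> = 1 - (1 - p) ^ m"
    by (induction m) (auto simp: algebra_simps)
  finally have prob: "measure_pmf.prob ?g {..m} = 1 - (1 - p) ^ m" .
  have weighted: "(\<Sum>k<n. (1 - p) ^ k * p * real (Suc k)) = (1 - (1 - p) ^ n * (p * n + 1)) / p" for n
    using p by (induction n) (auto simp: field_simps)
  have "tc p m = (\<Sum>k\<in>{..m}. real k * pmf (cond_pmf ?g {..m}) k)"
    unfolding tc_def by (rule integral_measure_pmf_real) (use ne in \<open>auto simp: set_cond_pmf\<close>)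
  also have "\<dots> = (\<Sum>k\<in>{..m}. pmf ?g k * real k) / measure_pmf.prob ?g {..m}"
    unfolding sum_divide_distrib by (rule sum.cong) (auto simp: pmf_cond[OF ne])
  also have "\<dots> = (1 - (1 - p) ^ m * (p * m + 1)) / (p * (1 - (1 - p) ^ m))"
    unfolding prob sum_Suc pmf_Suc weighted by simp
  finally show ?thesis .
qed

end

theory Submission
  imports Defs
begin

text \<open>The number of searched nodes is the number of prefixes of the order (the empty and the full
  one included) that contain no goal, so its expectation is the sum over all prefixes of the products
  of the probabilities \<open>1 - p\<close>. Grouped by levels, each level contributes a truncated geometric
  sum, and summation by parts against \<open>P(F\<^sub>k) = Q\<^sub>k - Q\<^sub>k\<^sub>+\<^sub>1\<close>, where
  \<open>Q\<^sub>k\<close> is the probability that there is no goal below level \<open>k\<close>, yields the claim.\<close>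

text \<open>If the first element of \<open>T\<close> is at position \<open>i\<close>, counted from
  1, exactly the prefixes of lengths \<open>0, ..., i - 1\<close> miss \<open>T\<close>. If there is
  none, all \<open>length xs + 1\<close> prefixes do, which matches the cost of an unsuccessful
  search.\<close>

lemma length_explored_eq_sum:
  "(if \<exists>v\<in>set xs. v \<in> T then length (explored T xs) else length xs + 1) =
     (\<Sum>j\<le>length xs. of_bool (set (take j xs) \<inter> T = {}))"
proof (induction xs)
  case (Cons x xs)
  then show ?case
    by (cases "x \<in> T")
      (auto simp: sum.atMost_Suc_shift simp del: sum.atMost_Suc sum_of_bool_eq split: if_splits)
qed simp

lemma nodes_searched_eq_sum:
  assumes "distinct xs" "set xs = verts G"
  shows "nodes_searched G xs T = (\<Sum>j\<le>length xs. of_bool (set (take j xs) \<inter> T = {}))"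
  unfolding length_explored_eq_sum[symmetric] nodes_searched_def
  using assms distinct_card[of xs] by simp

lemma (in prob_space) indep_events_prob_none:
  assumes indep: "indep_events A I" and "finite S" "S \<subseteq> I"
  shows "{\<omega> \<in> space M. \<forall>i\<in>S. \<omega> \<notin> A i} \<in> events"
    and "prob {\<omega> \<in> space M. \<forall>i\<in>S. \<omega> \<notin> A i} = (\<Prod>i\<in>S. 1 - prob (A i))"
proof -
  have ev: "A i \<in> events" if "i \<in> I" for i
    using indep that by (auto simp: indep_events_def)
  show "{\<omega> \<in> space M. \<forall>i\<in>S. \<omega> \<notin> A i} \<in> events"
  proof (rule sets.sets_Collect_finite_All)
    fix i assume "i \<in> S"
    then have "space M - A i \<in> events"
      using ev assms(3) by auto
    also have "space M - A i = {\<omega> \<in> space M. \<omega> \<notin> A i}" by auto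
    finally show "{\<omega> \<in> space M. \<omega> \<notin> A i} \<in> events" .
  qed (rule assms)
  show "prob {\<omega> \<in> space M. \<forall>i\<in>S. \<omega> \<notin> A i} = (\<Prod>i\<in>S. 1 - prob (A i))"
  \<comment> \<open>The empty intersection would be \<open>UNIV\<close> instead of
    \<open>space M\<close>, and the product rule is stated for nonempty index sets.\<close>
  proof (cases "S = {}")
    case True
    then show ?thesis by (simp add: prob_space)
  next
    case False
    \<comment> \<open>Passing to generated sigma-algebras makes the complements of the events
      available; each singleton generator is trivially closed under intersection.\<close>
    have "indep_sets (\<lambda>i. sigma_sets (space M) {A i}) I"
      using indep unfolding indep_events_def_alt
      by (rule indep_sets_sigma) (simp add: Int_stable_def)
    then have "prob (\<Inter>i\<in>S. space M - A i) = (\<Prod>i\<in>S. prob (space M - A i))"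
      using assms(2,3) False by (intro indep_setsD) (auto intro: sigma_sets.intros)
    moreover have "(\<Inter>i\<in>S. space M - A i) = {\<omega> \<in> space M. \<forall>i\<in>S. \<omega> \<notin> A i}"
      using False by auto
    moreover have "prob (space M - A i) = 1 - prob (A i)" if "i \<in> S" for i
      using that assms(3) by (intro prob_compl ev) auto
    ultimately show ?thesis by simp
  qed
qed

lemma prod_group_levels:
  fixes r :: "nat \<Rightarrow> 'b::comm_monoid_mult"
  assumes "finite V"
  shows "(\<Prod>v | v \<in> V \<and> f v < k. r (f v)) = (\<Prod>i<k. r i ^ card {v \<in> V. f v = i})"
proof -
  have "(\<Prod>v | v \<in> V \<and> f v < k. r (f v)) =
      (\<Prod>i<k. \<Prod>v | v \<in> {v \<in> V. f v < k} \<and> f v = i. r (f v))"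
    using assms by (subst prod.group) auto
  also have "\<dots> = (\<Prod>i<k. r i ^ card {v \<in> V. f v = i})"
  proof (rule prod.cong)
    fix i assume "i \<in> {..<k}"
    then have "{v. v \<in> {v \<in> V. f v < k} \<and> f v = i} = {v \<in> V. f v = i}" by auto
    then show "(\<Prod>v | v \<in> {v \<in> V. f v < k} \<and> f v = i. r (f v)) = r i ^ card {v \<in> V. f v = i}"
      by simp
  qed simp
  finally show ?thesis .
qed

text \<open>A prefix reaching into \<open>ys\<close> contains all of \<open>xs\<close>, so the
  product over \<open>xs\<close> factors out. The full list is left out of the sums; otherwise the
  prefix \<open>xs\<close> would be counted twice, the second time as the empty prefix of
  \<open>ys\<close>.\<close>

lemma sum_prod_take_append:
  fixes r :: "'a \<Rightarrow> 'b::comm_semiring_1"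
  shows "(\<Sum>j<length (xs @ ys). \<Prod>x\<leftarrow>take j (xs @ ys). r x) =
    (\<Sum>j<length xs. \<Prod>x\<leftarrow>take j xs. r x) +
    (\<Prod>x\<leftarrow>xs. r x) * (\<Sum>j<length ys. \<Prod>x\<leftarrow>take j ys. r x)"
proof (induction xs)
  case (Cons x xs)
  then show ?case
    by (simp add: sum.lessThan_Suc_shift sum_distrib_left[symmetric] algebra_simps
      del: sum.lessThan_Suc)
qed simp

text \<open>From the first occurrence of \<open>k\<close> on, sortedness and the bound leave only
  \<open>k\<close>. This peels off the deepest level in the induction over levels.\<close>

lemma sorted_split_last:
  assumes "sorted ns" "\<forall>n\<in>set ns. n < Suc k"
  shows "ns = filter (\<lambda>n. n < k) ns @ replicate (count_list ns k) k"
  using assms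
proof (induction ns)
  case (Cons n ns)
  show ?case
  proof (cases "n < k")
    case True
    with Cons show ?thesis by simp
  next
    case False
    with Cons.prems have [simp]: "n = k" and "\<forall>m\<in>set ns. m = k"
      by (auto simp: less_Suc_eq) (metis less_le_not_le)
    then have "filter (\<lambda>n. n < k) ns = []" by (auto simp: filter_empty_conv)
    with Cons show ?thesis by simp
  qed
qed simp

text \<open>Induction on the number of levels: the last level is a constant block, so its prefixes
  give a geometric sum, weighted by the product over all earlier levels. The induction step for the
  sum needs this product, hence the conjunction.\<close>

lemma sum_prod_take_sorted:
  fixes r :: "nat \<Rightarrow> 'b::comm_semiring_1"
  assumes "sorted ns" "\<forall>n\<in>set ns. n < K"
  shows "(\<Prod>n\<leftarrow>ns. r n) = (\<Prod>i<K. r i ^ count_list ns i) \<and>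
    (\<Sum>j<length ns. \<Prod>n\<leftarrow>take j ns. r n) =
      (\<Sum>k<K. (\<Prod>i<k. r i ^ count_list ns i) * (\<Sum>j<count_list ns k. r k ^ j))"
  using assms
proof (induction K arbitrary: ns)
  case (Suc K)
  define ms where "ms = filter (\<lambda>n. n < K) ns"
  have ns: "ns = ms @ replicate (count_list ns K) K"
    unfolding ms_def using Suc.prems by (rule sorted_split_last)
  have cnt: "count_list ms i = count_list ns i" if "i < K" for i
    using that by (simp add: ms_def count_list_eq_length_filter conj_commute) (metis (mono_tags, lifting))
  have "sorted ms" "\<forall>n\<in>set ms. n < K"
    using Suc.prems by (simp_all add: ms_def sorted_wrt_filter)
  note IH = Suc.IH[OF this]
  have prodms: "(\<Prod>n\<leftarrow>ms. r n) = (\<Prod>i<K. r i ^ count_list ns i)"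
    using IH cnt by simp
  have summs: "(\<Sum>j<length ms. \<Prod>n\<leftarrow>take j ms. r n) =
      (\<Sum>k<K. (\<Prod>i<k. r i ^ count_list ns i) * (\<Sum>j<count_list ns k. r k ^ j))"
    using IH cnt by simp
  have rep: "(\<Sum>j<length (replicate c K). \<Prod>n\<leftarrow>take j (replicate c K). r n) = (\<Sum>j<c. r K ^ j)" for c
    by (simp add: min_def)
  have "(\<Prod>n\<leftarrow>ns. r n) = (\<Prod>n\<leftarrow>ms. r n) * r K ^ count_list ns K"
    by (subst ns) simp
  moreover have "(\<Sum>j<length ns. \<Prod>n\<leftarrow>take j ns. r n) =
      (\<Sum>j<length ms. \<Prod>n\<leftarrow>take j ms. r n) + (\<Prod>n\<leftarrow>ms. r n) * (\<Sum>j<count_list ns K. r K ^ j)"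
    unfolding rep[symmetric] sum_prod_take_append[symmetric] ns[symmetric] ..
  ultimately show ?case
    by (simp add: prodms summs)
qed simp

text \<open>For a geometric \<open>X\<close>, the left side is the expectation of \<open>X\<close>
  restricted to \<open>X \<le> n\<close>, which is the sum over \<open>j < n\<close> of P(X > j) -
  P(X > n).\<close>

lemma one_minus_power_mult_tc:
  assumes "0 \<le> p" "p \<le> 1"
  shows "(1 - (1 - p) ^ n) * tc p n = (\<Sum>j<n. (1 - p) ^ j) - real n * (1 - p) ^ n"
proof (cases "p = 0 \<or> n = 0")
  case True
  \<comment> \<open>The factor in front of \<open>tc\<close> vanishes, so its unspecified value is
    harmless: this is the convention that 0 times undefined is 0.\<close>
  then show ?thesis by auto
next
  case False
  then have "0 < p" "1 \<le> n" using assms by auto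
  then have lt: "(1 - p) ^ n < 1" using assms by (simp add: power_less_one_iff)
  have gp: "(\<Sum>j<n. (1 - p) ^ j) = (1 - (1 - p) ^ n) / p"
    using \<open>0 < p\<close> by (simp add: sum_gp_strict)
  show ?thesis
    unfolding tc_explicit[OF \<open>0 < p\<close> assms(2) \<open>1 \<le> n\<close>] gp
    using \<open>0 < p\<close> lt by (simp add: field_simps)
qed

text \<open>Both sides express the expected cost of a search confined to the levels below
  \<open>K\<close>: by the level of the first goal on the left, by survival probabilities of
  prefixes on the right. The boundary term covers the case that all these levels are searched in
  vain.\<close>

lemma sum_tc_eq_sum_prod:
  fixes p :: "nat \<Rightarrow> real" and L :: "nat \<Rightarrow> nat"
  defines "Q \<equiv> \<lambda>k. \<Prod>i<k. (1 - p i) ^ L i"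
  assumes "\<And>k. k < K \<Longrightarrow> 0 \<le> p k \<and> p k \<le> 1"
  shows "(\<Sum>k<K. (1 - (1 - p k) ^ L k) * Q k * (real (\<Sum>i<k. L i) + tc (p k) (L k)))
      + Q K * real (\<Sum>i<K. L i) = (\<Sum>k<K. Q k * (\<Sum>j<L k. (1 - p k) ^ j))"
  using assms(2)
proof (induction K)
  case (Suc K)
  have Q: "Q (Suc K) = Q K * (1 - p K) ^ L K"
    by (simp add: Q_def)
  have "Q K * ((1 - (1 - p K) ^ L K) * tc (p K) (L K)) =
      Q K * ((\<Sum>j<L K. (1 - p K) ^ j) - real (L K) * (1 - p K) ^ L K)"
    using Suc.prems[of K] by (subst one_minus_power_mult_tc) auto
  moreover have "(\<Sum>k<K. (1 - (1 - p k) ^ L k) * Q k * (real (\<Sum>i<k. L i) + tc (p k) (L k)))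
      + Q K * real (\<Sum>i<K. L i) = (\<Sum>k<K. Q k * (\<Sum>j<L k. (1 - p k) ^ j))"
    using Suc by simp
  ultimately show ?case
    unfolding sum.lessThan_Suc Q of_nat_add by (simp only: algebra_simps)
qed simp

theorem proposition17:
  fixes G :: "('a, 'e) pre_digraph" and v0 :: 'a and D :: nat
    and p :: "nat \<Rightarrow> real"
    and M :: "'w measure" and goals :: "'w \<Rightarrow> 'a set"
    and xs :: "'a list" and m :: nat
  assumes graph: "fin_digraph G" and start: "v0 \<in> verts G"
    and reach: "\<And>v. v \<in> verts G \<Longrightarrow> v0 \<rightarrow>\<^sup>*\<^bsub>G\<^esub> v"
    and D: "D = max_level G v0"
    and p01: "\<And>k. k \<le> D \<Longrightarrow> 0 \<le> p k \<and> p k \<le> 1"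
    and p_nonzero: "\<exists>k\<le>D. p k \<noteq> 0"
    and p_ext: "p (D + 1) = 1"
    and M: "prob_space M"
    and indep: "prob_space.indep_events M (\<lambda>v. {\<omega> \<in> space M. v \<in> goals \<omega>}) (verts G)"
    and goal_prob: "\<And>v. v \<in> verts G \<Longrightarrow>
        measure M {\<omega> \<in> space M. v \<in> goals \<omega>} = p (level G v0 v)"
    and order: "bfs_order G v0 xs"
    and m: "1 \<le> m"
  defines "L \<equiv> level_size G v0"
    and "U \<equiv> \<lambda>k. \<Sum>i<k. level_size G v0 i"
    and "F \<equiv> first_goal_level M G v0 goals"
  shows "integrable M (\<lambda>\<omega>. real (nodes_searched G xs (goals \<omega>)))
       \<and> prob_space.expectation M (\<lambda>\<omega>. real (nodes_searched G xs (goals \<omega>))) =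
           (\<Sum>k = 0..D + 1. measure M (F k) *
              (real (U k) + tc (p k) (if k = D + 1 then m else L k)))
       \<and> (\<forall>k\<le>D. measure M (F k) =
            (1 - (1 - p k) ^ L k) * (\<Prod>i<k. (1 - p i) ^ L i))"
proof -
  interpret prob_space M by (rule M)
  interpret fin_digraph G by (rule graph)
  define r where "r i = 1 - p i" for i
  define Q where "Q k = (\<Prod>i<k. r i ^ L i)" for k
  define avoid where "avoid S = {\<omega> \<in> space M. S \<inter> goals \<omega> = {}}" for S
  have level_le: "level G v0 v \<le> D" if "v \<in> verts G" for v
    using that by (simp add: D max_level_def)
  have avoid_alt: "avoid S = {\<omega> \<in> space M. \<forall>v\<in>S. \<omega> \<notin> {\<omega> \<in> space M. v \<in> goals \<omega>}}" for S
    by (auto simp: avoid_def)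
  have fin: "finite S" if "S \<subseteq> verts G" for S
    using that finite_verts by (rule finite_subset)
  have avoid_ev: "avoid S \<in> events" if "S \<subseteq> verts G" for S
    unfolding avoid_alt using indep fin[OF that] that by (rule indep_events_prob_none)
  have prob_avoid: "prob (avoid S) = (\<Prod>v\<in>S. r (level G v0 v))" if "S \<subseteq> verts G" for S
  proof -
    have "prob (avoid S) = (\<Prod>v\<in>S. 1 - prob {\<omega> \<in> space M. v \<in> goals \<omega>})"
      unfolding avoid_alt using indep fin[OF that] that by (rule indep_events_prob_none)
    also have "\<dots> = (\<Prod>v\<in>S. r (level G v0 v))"
      using that by (intro prod.cong) (auto simp: goal_prob r_def)
    finally show ?thesis .
  qed
  define below where "below k = {v \<in> verts G. level G v0 v < k}" for k
  have below_sub: "below k \<subseteq> verts G" for k by (auto simp: below_def)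
  have prob_below: "prob (avoid (below k)) = Q k" for k
    unfolding prob_avoid[OF below_sub] Q_def L_def level_size_def
    unfolding below_def by (rule prod_group_levels) simp
  have prob_F: "prob (F k) = (1 - r k ^ L k) * Q k" if "k \<le> D" for k
  proof -
    \<comment> \<open>As a difference of nested avoidance events, \<open>F k\<close> has probability
      \<open>Q k - Q (Suc k)\<close>.\<close>
    have "F k = avoid (below k) - avoid (below (Suc k))"
      using that by (auto simp: F_def first_goal_level_def D goal_on_level_def avoid_def below_def
          less_Suc_eq)
    moreover have "avoid (below (Suc k)) \<subseteq> avoid (below k)"
      by (auto simp: avoid_def below_def)
    ultimately have "prob (F k) = Q k - Q (Suc k)"
      by (simp add: finite_measure_Diff avoid_ev below_sub prob_below)
    then show ?thesis by (simp add: Q_def algebra_simps)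
  qed
  have below_all: "below (Suc D) = verts G"
    using level_le by (auto simp: below_def less_Suc_eq_le)
  have "F (Suc D) = avoid (verts G)"
    by (auto simp: F_def first_goal_level_def D avoid_def)
  then have prob_F_last: "prob (F (Suc D)) = Q (Suc D)"
    using prob_below[of "Suc D"] by (simp add: below_all)

  have xs: "distinct xs" "set xs = verts G" "sorted (map (level G v0) xs)"
    using order by (auto simp: bfs_order_def)
  have take_sub: "set (take j xs) \<subseteq> verts G" for j
    using set_take_subset[of j xs] xs by simp
  \<comment> \<open>The count becomes a finite sum of indicators, which yields both integrability
    and, by linearity, the expectation.\<close>
  have N: "real (nodes_searched G xs (goals \<omega>)) =
      (\<Sum>j\<le>length xs. indicator (avoid (set (take j xs))) \<omega>)" if "\<omega> \<in> space M" for \<omega>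
    using that unfolding nodes_searched_eq_sum[OF xs(1,2)] of_nat_sum
    by (intro sum.cong) (auto simp: avoid_def indicator_def)
  have int: "integrable M (\<lambda>\<omega>. indicator (avoid (set (take j xs))) \<omega> :: real)" for j
    using avoid_ev[OF take_sub] by (simp add: integrable_indicator_iff less_top[symmetric])
  have "integrable M (\<lambda>\<omega>. real (nodes_searched G xs (goals \<omega>)))"
    by (subst Bochner_Integration.integrable_cong[OF refl N]) (use int in auto)
  moreover have "expectation (\<lambda>\<omega>. real (nodes_searched G xs (goals \<omega>))) =
      (\<Sum>k = 0..D + 1. prob (F k) * (real (U k) + tc (p k) (if k = D + 1 then m else L k)))"
  proof -
    define ns where "ns = map (level G v0) xs"
    have ns: "sorted ns" "\<forall>n\<in>set ns. n < Suc D"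
      using xs level_le by (auto simp: ns_def less_Suc_eq_le)
    have cnt: "count_list ns k = L k" for k
    proof -
      have "count_list ns k = length (filter (\<lambda>v. level G v0 v = k) xs)"
        by (simp add: ns_def count_list_eq_length_filter filter_map o_def eq_commute)
      also have "\<dots> = card (set (filter (\<lambda>v. level G v0 v = k) xs))"
        using xs by (intro distinct_card[symmetric]) simp
      finally show ?thesis by (simp add: L_def level_size_def xs)
    qed
    \<comment> \<open>Only the levels of the nodes matter from here on; the order inside a level
      drops out because \<open>ns\<close> is determined by the level sizes.\<close>
    have "prob (avoid (set (take j xs))) = (\<Prod>n\<leftarrow>take j ns. r n)" for j
      unfolding prob_avoid[OF take_sub] ns_def take_map using xs
      by (simp add: prod.distinct_set_conv_list o_def)
    then have "expectation (\<lambda>\<omega>. real (nodes_searched G xs (goals \<omega>))) =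
        (\<Sum>j\<le>length ns. \<Prod>n\<leftarrow>take j ns. r n)"
      using int avoid_ev[OF take_sub]
      by (subst Bochner_Integration.integral_cong[OF refl N]) (auto simp: ns_def)
    \<comment> \<open>The full prefix is split off: it survives exactly when no goal exists and
      accounts for the additional 1 in the cost of failure.\<close>
    also have "\<dots> = (\<Sum>j<length ns. \<Prod>n\<leftarrow>take j ns. r n) + (\<Prod>n\<leftarrow>ns. r n)"
      by (simp add: lessThan_Suc_atMost[symmetric])
    also have "\<dots> = (\<Sum>k<Suc D. Q k * (\<Sum>j<L k. r k ^ j)) + Q (Suc D)"
      using sum_prod_take_sorted[OF ns, of r] unfolding cnt Q_def by simp
    also have "(\<Sum>k<Suc D. Q k * (\<Sum>j<L k. r k ^ j)) =
        (\<Sum>k<Suc D. (1 - r k ^ L k) * Q k * (real (U k) + tc (p k) (L k))) + Q (Suc D) * real (U (Suc D))"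
      using sum_tc_eq_sum_prod[of "Suc D" p L] p01
      unfolding Q_def r_def U_def L_def by (simp only: less_Suc_eq_le)
    also have "(\<Sum>k<Suc D. (1 - r k ^ L k) * Q k * (real (U k) + tc (p k) (L k))) =
        (\<Sum>k<Suc D. prob (F k) * (real (U k) + tc (p k) (L k)))"
      by (intro sum.cong) (auto simp: prob_F)
    \<comment> \<open>The boundary term and the full prefix merge into the summand for level
      \<open>D + 1\<close>, since \<open>tc 1 m = 1\<close> for \<open>m \<ge> 1\<close>.\<close>
    also have "\<dots> + Q (Suc D) * real (U (Suc D)) + Q (Suc D) =
        (\<Sum>k<Suc D. prob (F k) * (real (U k) + tc (p k) (L k)))
          + prob (F (Suc D)) * (real (U (Suc D)) + tc (p (Suc D)) m)"
      using m p_ext by (simp add: prob_F_last tc_explicit power_0_left algebra_simps)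
    also have "\<dots> = (\<Sum>k<Suc (Suc D). prob (F k) *
        (real (U k) + tc (p k) (if k = D + 1 then m else L k)))"
      unfolding sum.lessThan_Suc[of _ "Suc D"] by (intro arg_cong2[of _ _ _ _ "(+)"] sum.cong) auto
    finally show ?thesis
      by (simp only: atLeast0AtMost lessThan_Suc_atMost Suc_eq_plus1[symmetric])
  qed
  ultimately show ?thesis
    using prob_F by (simp add: Q_def r_def)
qed

end
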